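(* For every non-negative integer $n$ and every integer $s$, \[ \sum_{k = 1}^{\lceil n/2 \rceil } \binom {n}{2k-1} F_{6k + s} = 2^{n-1} \big(F_{2n+3+s} - (-1)^n F_{n+3+s}\big),\qquad \sum_{k = 1}^{\lceil n/2 \rceil } \binom {n}{2k-1} L_{6k + s} = 2^{n-1}\big(L_{2n+3+s} - (-1)^n L_{n+3+s}\big). \]
   Context: The Fibonacci numbers $F_j$ and Lucas numbers $L_j$ are defined for all integers $j$ by $F_0=0$, $F_1=1$, $L_0=2$, $L_1=1$, $F_j=F_{j-1}+F_{j-2}$, $L_j=L_{j-1}+L_{j-2}$, with $F_{-j}=(-1)^{j-1}F_j$ and $L_{-j}=(-1)^jL_j$. An empty sum equals $0$. *)

theory Defs
  imports Complex_Main "HOL-Number_Theory.Fib"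
begin

fun lucas :: "nat \<Rightarrow> nat" where
  "lucas 0 = 2"
| "lucas (Suc 0) = 1"
| "lucas (Suc (Suc n)) = lucas (Suc n) + lucas n"

definition fib_int :: "int \<Rightarrow> int" where
  "fib_int j = (if j \<ge> 0 then int (fib (nat j)) else (-1) ^ (nat (-j) - 1) * int (fib (nat (-j))))"

definition lucas_int :: "int \<Rightarrow> int" where
  "lucas_int j = (if j \<ge> 0 then int (lucas (nat j)) else (-1) ^ nat (-j) * int (lucas (nat (-j))))"

lemma fib_int_init: "fib_int 0 = 0" "fib_int 1 = 1"
  by (simp_all add: fib_int_def)

lemma lucas_int_init: "lucas_int 0 = 2" "lucas_int 1 = 1"
  by (simp_all add: lucas_int_def)

lemma fib_int_rec: "fib_int j = fib_int (j - 1) + fib_int (j - 2)"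
proof -
  consider (pos) n where "j = int n + 2" | (one) "j = 1" | (zero) "j = 0" | (neg) n where "j = - int n - 1"
  proof -
    have "j = int (nat (j - 2)) + 2 \<or> j = 1 \<or> j = 0 \<or> j = - int (nat (-j - 1)) - 1" by linarith
    then show thesis using that by blast
  qed
  then show ?thesis
  proof cases
    case (pos n)
    have "nat (int n + 2) = Suc (Suc n)" "nat (1 + int n) = Suc n" by linarith+
    with pos show ?thesis by (simp add: fib_int_def)
  next
    case (neg n)
    have "nat (- j) = Suc n" "nat (- (j - 1)) = Suc (Suc n)" "nat (- (j - 2)) = Suc (Suc (Suc n))" "j < 0"
      using neg by linarith+
    then show ?thesis by (simp add: fib_int_def algebra_simps del: minus_diff_eq)
  qed (simp_all add: fib_int_def numeral_eq_Suc)
qed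

lemma lucas_int_rec: "lucas_int j = lucas_int (j - 1) + lucas_int (j - 2)"
proof -
  consider (pos) n where "j = int n + 2" | (one) "j = 1" | (zero) "j = 0" | (neg) n where "j = - int n - 1"
  proof -
    have "j = int (nat (j - 2)) + 2 \<or> j = 1 \<or> j = 0 \<or> j = - int (nat (-j - 1)) - 1" by linarith
    then show thesis using that by blast
  qed
  then show ?thesis
  proof cases
    case (pos n)
    have "nat (int n + 2) = Suc (Suc n)" "nat (1 + int n) = Suc n" by linarith+
    with pos show ?thesis by (simp add: lucas_int_def)
  next
    case (neg n)
    have "nat (- j) = Suc n" "nat (- (j - 1)) = Suc (Suc n)" "nat (- (j - 2)) = Suc (Suc (Suc n))" "j < 0"
      using neg by linarith+
    then show ?thesis by (simp add: lucas_int_def algebra_simps del: minus_diff_eq)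
  qed (simp_all add: lucas_int_def numeral_eq_Suc)
qed

end

theory Submission
  imports Defs
begin

text \<open>
  Let \<open>x\<close> be a root of \<open>x\<^sup>2 = x + 1\<close>. Then \<open>1 + x\<^sup>3 = 2 x\<^sup>2\<close> and \<open>1 - x\<^sup>3 = - 2 x\<close>, so the binomial
  theorem evaluates the sums of \<open>(n choose j) x\<^bsup>3j\<^esup>\<close> and of \<open>(-1)\<^sup>j (n choose j) x\<^bsup>3j\<^esup>\<close> as
  \<open>2\<^sup>n x\<^bsup>2n\<^esup>\<close> and \<open>(-2)\<^sup>n x\<^sup>n\<close>. Half their difference is the sum over odd \<open>j = 2k - 1\<close>.
  The argument only uses the recurrence, so it is carried out for every two-sided sequence
  satisfying \<open>G j = G (j - 1) + G (j - 2)\<close>.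
\<close>

text \<open>Pascal's rule, arranged so that lowering the upper index replaces \<open>f\<close> by
  the sum of \<open>f\<close> and its shift.\<close>

lemma sum_choose_Suc:
  fixes f :: "nat \<Rightarrow> 'a::comm_semiring_1"
  shows "(\<Sum>j\<le>Suc n. of_nat (Suc n choose j) * f j)
       = (\<Sum>j\<le>n. of_nat (n choose j) * (f j + f (Suc j)))"
proof -
  have "(\<Sum>j\<le>Suc n. of_nat (Suc n choose j) * f j)
      = f 0 + (\<Sum>j\<le>n. of_nat (n choose Suc j) * f (Suc j)) + (\<Sum>j\<le>n. of_nat (n choose j) * f (Suc j))"
    by (simp add: sum.atMost_Suc_shift sum.distrib algebra_simps del: sum.atMost_Suc)
  \<comment> \<open>The term \<open>f 0\<close> fills the slot j = 0; the top term j = n + 1 has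
    coefficient zero and is dropped at the end.\<close>
  also have "f 0 + (\<Sum>j\<le>n. of_nat (n choose Suc j) * f (Suc j))
      = (\<Sum>j\<le>Suc n. of_nat (n choose j) * f j)"
    by (simp add: sum.atMost_Suc_shift del: sum.atMost_Suc)
  finally show ?thesis
    by (simp add: sum.distrib distrib_left binomial_eq_0)
qed

text \<open>With E the shift operator, \<open>step\<close> says that 1 + c E^r acts on
  \<open>G\<close> as d E^e; the n-th power of this identity is expanded binomially. Each induction
  step moves \<open>s\<close> by \<open>e\<close>, so \<open>s\<close> is generalised.\<close>

lemma binomial_sum_shift:
  fixes G :: "int \<Rightarrow> 'a::comm_ring_1" and r e s :: int
  assumes step: "\<And>s. G s + c * G (s + r) = d * G (s + e)"
  shows "(\<Sum>j\<le>n. of_nat (n choose j) * (c ^ j * G (r * int j + s))) = d ^ n * G (e * int n + s)"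
proof (induction n arbitrary: s)
  case 0
  show ?case by simp
next
  case (Suc n)
  have eq: "c ^ j * G (r * int j + s) + c ^ Suc j * G (r * int (Suc j) + s)
      = d * (c ^ j * G (r * int j + (s + e)))" for j
    using arg_cong[OF step[of "r * int j + s"], of "\<lambda>x. c ^ j * x"] by (simp add: algebra_simps)
  have "(\<Sum>j\<le>Suc n. of_nat (Suc n choose j) * (c ^ j * G (r * int j + s)))
      = d * (\<Sum>j\<le>n. of_nat (n choose j) * (c ^ j * G (r * int j + (s + e))))"
    unfolding sum_choose_Suc eq by (simp add: sum_distrib_left mult.left_commute)
  also have "\<dots> = d ^ Suc n * G (e * int (Suc n) + s)"
    unfolding Suc.IH by (simp add: algebra_simps)
  finally show ?case .
qed

text \<open>The weight 1 - (-1)^j is 2 for odd j and 0 for even j.\<close>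

lemma sum_odd_indices:
  fixes f :: "nat \<Rightarrow> 'a::comm_ring_1"
  shows "2 * (\<Sum>k = 1..(n + 1) div 2. f (2 * k - 1)) = (\<Sum>j\<le>n. f j) - (\<Sum>j\<le>n. (-1) ^ j * f j)"
proof -
  have "(\<Sum>k = 1..(n + 1) div 2. f (2 * k - 1)) = (\<Sum>j | j \<le> n \<and> odd j. f j)"
    by (rule sum.reindex_bij_witness[of _ "\<lambda>j. (j + 1) div 2" "\<lambda>k. 2 * k - 1"])
       (auto elim!: oddE)
  also have "2 * \<dots> = (\<Sum>j | j \<le> n \<and> odd j. f j - (-1) ^ j * f j)"
    unfolding sum_distrib_left by (rule sum.cong) auto
  also have "\<dots> = (\<Sum>j\<le>n. f j - (-1) ^ j * f j)"
    by (rule sum.mono_neutral_left) auto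
  finally show ?thesis
    by (simp add: sum_subtractf)
qed

lemma odd_binomial_sum_fibonacci_like:
  fixes G :: "int \<Rightarrow> real" and n :: nat and s :: int
  assumes rec: "\<And>j. G j = G (j - 1) + G (j - 2)"
  shows "(\<Sum>k = 1..nat \<lceil>real n / 2\<rceil>. real (n choose (2 * k - 1)) * G (6 * int k + s))
       = 2 powi (int n - 1) * (G (2 * int n + 3 + s) - (-1) ^ n * G (int n + 3 + s))"
proof -
  \<comment> \<open>The offset s + 3 comes from 6k + s = 3(2k - 1) + (s + 3).\<close>
  define f where "f j = real (n choose j) * G (3 * int j + (s + 3))" for j
  \<comment> \<open>Together these give G t + G (t + 3) = 2 G (t + 2) and G t - G (t + 3) = -2 G (t
    + 1).\<close>
  have rec1: "G (t + 3) = G (t + 2) + G (t + 1)" and rec2: "G (t + 2) = G (t + 1) + G t" for t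
    using rec[of "t + 3"] rec[of "t + 2"] by (simp_all add: algebra_simps)
  have plus: "(\<Sum>j\<le>n. f j) = 2 ^ n * G (2 * int n + (s + 3))"
    using binomial_sum_shift[of G 1 3 2 2 n "s + 3"] rec1 rec2 by (simp add: f_def)
  have minus: "(\<Sum>j\<le>n. (-1) ^ j * f j) = (-2) ^ n * G (int n + (s + 3))"
    using binomial_sum_shift[of G "-1" 3 "-2" 1 n "s + 3"] rec1 rec2
    by (simp add: f_def mult.left_commute)
  have "nat \<lceil>real n / 2\<rceil> = (n + 1) div 2"
    by (cases "even n") (auto elim!: evenE oddE simp: ceiling_eq_iff nat_eq_iff field_simps)
  then have "(\<Sum>k = 1..nat \<lceil>real n / 2\<rceil>. real (n choose (2 * k - 1)) * G (6 * int k + s))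
      = (\<Sum>k = 1..(n + 1) div 2. f (2 * k - 1))"
    by (intro sum.cong) (auto simp: f_def of_nat_diff algebra_simps)
  also have "\<dots> = (2 ^ n * G (2 * int n + (s + 3)) - (-2) ^ n * G (int n + (s + 3))) / 2"
    using sum_odd_indices[of f n] by (simp add: plus minus)
  \<comment> \<open>The integer exponent absorbs the division by 2 even for n = 0, where the power
    is 1/2.\<close>
  also have "\<dots> = 2 powi (int n - 1) * (G (2 * int n + 3 + s) - (-1) ^ n * G (int n + 3 + s))"
    by (simp add: power_int_diff power_minus[of 2] field_simps)
  finally show ?thesis .
qed

theorem theorem18:
  fixes n :: nat and s :: int
  shows "(\<Sum>k = 1..nat \<lceil>real n / 2\<rceil>. real (n choose (2 * k - 1)) * real_of_int (fib_int (6 * int k + s)))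
           = 2 powi (int n - 1) *
             (real_of_int (fib_int (2 * int n + 3 + s)) - (-1) ^ n * real_of_int (fib_int (int n + 3 + s)))
       \<and> (\<Sum>k = 1..nat \<lceil>real n / 2\<rceil>. real (n choose (2 * k - 1)) * real_of_int (lucas_int (6 * int k + s)))
           = 2 powi (int n - 1) *
             (real_of_int (lucas_int (2 * int n + 3 + s)) - (-1) ^ n * real_of_int (lucas_int (int n + 3 + s)))"
proof (intro conjI odd_binomial_sum_fibonacci_like)
  show "real_of_int (fib_int j) = real_of_int (fib_int (j - 1)) + real_of_int (fib_int (j - 2))" for j
    by (subst fib_int_rec) simp
  show "real_of_int (lucas_int j) = real_of_int (lucas_int (j - 1)) + real_of_int (lucas_int (j - 2))" for j
    by (subst lucas_int_rec) simp
qed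

end
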